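(* Let $0<\rho<1/2$ and let $d>0$. Suppose that there are an integer $m\ge 1$ and an odd integer $B\ge 3$ such that $\rho^{-m}=B$. Then $L^2(\mu_{\rho,d})$ admits no Fourier frame.
   Context: For $0<\rho<1$ and $d>0$, $\mu_{\rho,d}$ denotes the symmetric two-branch Bernoulli convolution, i.e. the infinite convolution $$\mu_{\rho,d}=\ast_{j=1}^{\infty}\tfrac12\bigl(\delta_{-d\rho^j/2}+\delta_{d\rho^j/2}\bigr).$$ Equivalently, $\mu_{\rho,d}$ is the Borel probability measure on $\mathbb R$ which is the distribution of the random series $\sum_{j=1}^\infty \frac{d\xi_j\rho^j}{2}$, where $\xi_1,\xi_2,\ldots$ are independent and each is uniformly distributed on $\{-1,1\}$. For a compactly supported Borel probability measure $\mu$ on $\mathbb R$, $L^2(\mu)$ is the complex Hilbert space with inner product $\langle f,g\rangle_{L^2(\mu)}=\int_{\mathbb R} f\,\overline{g}\,d\mu$, and $e_\lambda(x)=e^{2\pi i\lambda x}$ for $\lambda\in\mathbb R$. A countable set $\Lambda\subset\mathbb R$ is a Fourier frame spectrum for $\mu$ if there exist constants $0<A\le C<\infty$ such that $$A\|f\|_{L^2(\mu)}^2\le\sum_{\lambda\in\Lambda}|\langle f,e_\lambda\rangle_{L^2(\mu)}|^2\le C\|f\|_{L^2(\mu)}^2\quad\text{for all } f\in L^2(\mu).$$ $L^2(\mu)$ admits a Fourier frame if some Fourier frame spectrum for $\mu$ exists. *)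

theory Defs
  imports "HOL-Probability.Probability"
begin

definition sign_sequences :: "(nat \<Rightarrow> real) measure" where
  "sign_sequences = (\<Pi>\<^sub>M j\<in>UNIV. measure_pmf (pmf_of_set {-1, 1}))"

text \<open>Indices start at 0 here, so \<open>\<xi> j\<close> is the usual \<open>\<xi>\<^bsub>j+1\<^esub>\<close>.\<close>

definition bernoulli_series :: "real \<Rightarrow> real \<Rightarrow> (nat \<Rightarrow> real) \<Rightarrow> real" where
  "bernoulli_series \<rho> d \<xi> = (\<Sum>j. d * \<xi> j * \<rho> ^ Suc j / 2)"

text \<open>The law of the random series, which is the infinite convolution of the measures
  \<open>(\<delta>\<^bsub>-d\<rho>^j/2\<^esub> + \<delta>\<^bsub>d\<rho>^j/2\<^esub>)/2\<close> over \<open>j \<ge> 1\<close> when \<open>0 < \<rho> < 1\<close>.\<close>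

definition bernoulli_convolution :: "real \<Rightarrow> real \<Rightarrow> real measure" where
  "bernoulli_convolution \<rho> d = distr sign_sequences borel (bernoulli_series \<rho> d)"

text \<open>Representatives of the elements of \<open>L\<^sup>2(M)\<close>. The quantities used below depend only on
  the class of a function modulo equality almost everywhere.\<close>

definition L2_functions :: "real measure \<Rightarrow> (real \<Rightarrow> complex) set" where
  "L2_functions M = {f \<in> borel_measurable M. integrable M (\<lambda>x. (cmod (f x))\<^sup>2)}"

definition L2_inner :: "real measure \<Rightarrow> (real \<Rightarrow> complex) \<Rightarrow> (real \<Rightarrow> complex) \<Rightarrow> complex" where
  "L2_inner M f g = (LINT x|M. f x * cnj (g x))"

definition L2_norm :: "real measure \<Rightarrow> (real \<Rightarrow> complex) \<Rightarrow> real" where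
  "L2_norm M f = sqrt (LINT x|M. (cmod (f x))\<^sup>2)"

definition exponential :: "real \<Rightarrow> real \<Rightarrow> complex" where
  "exponential l x = exp (2 * complex_of_real pi * \<i> * complex_of_real l * complex_of_real x)"

text \<open>\<open>infsum\<close> is 0 when the sum diverges, so the finiteness contained in the upper bound
  has to be stated as \<open>summable_on\<close>.\<close>

definition fourier_frame_spectrum :: "real measure \<Rightarrow> real set \<Rightarrow> bool" where
  "fourier_frame_spectrum M \<Lambda> \<longleftrightarrow>
     countable \<Lambda> \<and>
     (\<exists>A C :: real. 0 < A \<and> A \<le> C \<and>
       (\<forall>f \<in> L2_functions M.
          (\<lambda>l. (cmod (L2_inner M f (exponential l)))\<^sup>2) summable_on \<Lambda> \<and>
          A * (L2_norm M f)\<^sup>2 \<le> (\<Sum>\<^sub>\<infinity>l\<in>\<Lambda>. (cmod (L2_inner M f (exponential l)))\<^sup>2) \<and>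
          (\<Sum>\<^sub>\<infinity>l\<in>\<Lambda>. (cmod (L2_inner M f (exponential l)))\<^sup>2) \<le> C * (L2_norm M f)\<^sup>2))"

definition admits_fourier_frame :: "real measure \<Rightarrow> bool" where
  "admits_fourier_frame M \<longleftrightarrow> (\<exists>\<Lambda>. fourier_frame_spectrum M \<Lambda>)"

lemma measurable_sign_component [measurable]:
  "(\<lambda>\<xi>. \<xi> j) \<in> borel_measurable sign_sequences"
proof -
  have "(\<lambda>\<xi>. \<xi> j) \<in> measurable sign_sequences (measure_pmf (pmf_of_set {-1, 1 :: real}))"
    unfolding sign_sequences_def by (rule measurable_component_singleton) simp
  from measurable_compose[OF this, of "\<lambda>x. x" borel] show ?thesis by simp
qed

lemma measurable_bernoulli_series [measurable]:
  "bernoulli_series \<rho> d \<in> borel_measurable sign_sequences"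
  unfolding bernoulli_series_def by measurable

lemma prob_space_sign_sequences: "prob_space sign_sequences"
  unfolding sign_sequences_def by (intro prob_space_PiM measure_pmf.prob_space_axioms)

lemma prob_space_bernoulli_convolution: "prob_space (bernoulli_convolution \<rho> d)"
  unfolding bernoulli_convolution_def
  by (intro prob_space.prob_space_distr prob_space_sign_sequences measurable_bernoulli_series)

lemma sets_bernoulli_convolution [simp]: "sets (bernoulli_convolution \<rho> d) = sets borel"
  by (simp add: bernoulli_convolution_def)

end

theory Submission
  imports Defs
begin

text \<open>
  Number the signs \<open>\<xi> 0, \<xi> 1, \<dots>\<close>. Since \<open>\<rho> < 1/2\<close>, the sum \<open>x\<close> of the random series determines all
  signs, so every sign is a Borel function \<open>r\<^sub>n\<close> of \<open>x\<close>. Independence of the signs turns a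
  Fourier coefficient of a product of signs into a product. With
  \<open>\<alpha>\<^sub>n = \<pi> \<lambda> d \<rho>^(n+1)\<close>, two indices \<open>p \<noteq> q\<close>, and a number \<open>P \<in> [0, 1]\<close> that collects all other
  signs, the squared moduli of the coefficients at \<open>\<lambda>\<close> are
    \<^item> \<open>P cos\<^sup>2 \<alpha>\<^sub>p cos\<^sup>2 \<alpha>\<^sub>q\<close> for the constant function \<open>1\<close>,
    \<^item> \<open>P cos\<^sup>2 \<alpha>\<^sub>p sin\<^sup>2 \<alpha>\<^sub>q\<close> for \<open>r\<^sub>q\<close>,
    \<^item> \<open>P sin\<^sup>2 \<alpha>\<^sub>p sin\<^sup>2 \<alpha>\<^sub>q\<close> for \<open>r\<^sub>p r\<^sub>q\<close>
  (lemma \<open>cmod_L2_inner_two_digits\<close>).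

  Now let \<open>q = p + m\<close>. Then \<open>\<alpha>\<^sub>p = B \<alpha>\<^sub>q\<close>, and this is where odd \<open>B\<close> matters: the middle
  coefficient cannot be large while the other two are small. To make the first one much smaller
  than the second, \<open>cos \<alpha>\<^sub>q\<close> has to be nearly \<open>0\<close>; but for odd \<open>B\<close> one has
  \<open>\<bar>cos (B \<alpha>)\<bar> \<le> B \<bar>cos \<alpha>\<bar>\<close>, so then \<open>cos \<alpha>\<^sub>p\<close> is nearly \<open>0\<close> as well and the third coefficient
  dominates the second. Quantitatively (lemma \<open>cos_odd_multiple_sin_squared_le\<close>), for every
  \<open>\<epsilon> > 0\<close> there is a \<open>K\<close>, independent of \<open>\<lambda>\<close> and \<open>p\<close>, with
  \<open>|\<langle>r\<^sub>q, e\<^sub>\<lambda>\<rangle>|\<^sup>2 \<le> \<epsilon> |\<langle>r\<^sub>p r\<^sub>q, e\<^sub>\<lambda>\<rangle>|\<^sup>2 + K |\<langle>1, e\<^sub>\<lambda>\<rangle>|\<^sup>2\<close>.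

  Suppose that \<open>\<Lambda>\<close> is a frame spectrum with bounds \<open>A \<le> C\<close>. All three functions have norm 1.
  Choose a finite \<open>F \<subseteq> \<Lambda>\<close> outside of which the coefficients of \<open>1\<close> contribute very little, and
  sum the inequality over \<open>\<Lambda> - F\<close>: the part of the frame sum of \<open>r\<^sub>q\<close> outside \<open>F\<close> is at most
  \<open>\<epsilon> C\<close> plus a small number, hence at most \<open>A/2\<close>. So \<open>F\<close> carries at least \<open>A/2\<close> for every \<open>q\<close>. But
  \<open>F\<close> is finite and does not depend on \<open>q\<close>, while for fixed \<open>\<lambda>\<close> the coefficient of \<open>r\<^sub>q\<close> is at most
  \<open>\<bar>sin \<alpha>\<^sub>q\<bar>\<close>, which tends to \<open>0\<close> as \<open>q \<rightarrow> \<infinity>\<close>: a contradiction.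
\<close>

section \<open>A trigonometric inequality for odd multiples\<close>

text \<open>For odd \<open>n\<close>, \<open>cos (n x)\<close> vanishes wherever \<open>cos x\<close> does. For even \<open>n\<close> it does not, and no bound
  of this kind holds.\<close>

lemma abs_cos_odd_multiple_le:
  fixes x :: real
  shows "\<bar>cos (real (2 * k + 1) * x)\<bar> \<le> real (2 * k + 1) * \<bar>cos x\<bar>"
proof (induction k)
  case 0
  show ?case by simp
next
  case (Suc k)
  define y where "y = real (2 * k + 1) * x"
  have "real (2 * Suc k + 1) * x = y + 2 * x"
    by (simp add: y_def algebra_simps)
  then have "cos (real (2 * Suc k + 1) * x) = cos y * cos (2 * x) - sin y * (2 * sin x * cos x)"
    by (simp add: cos_add sin_double)
  also have "\<bar>\<dots>\<bar> \<le> \<bar>cos y * cos (2 * x)\<bar> + \<bar>sin y * (2 * sin x * cos x)\<bar>"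
    by (rule abs_triangle_ineq4)
  also have "\<bar>cos y * cos (2 * x)\<bar> \<le> \<bar>cos y\<bar>"
    using mult_left_mono[OF abs_cos_le_one[of "2 * x"], of "\<bar>cos y\<bar>"] by (simp add: abs_mult)
  also have "\<bar>sin y * (2 * sin x * cos x)\<bar> = (\<bar>sin y\<bar> * \<bar>sin x\<bar>) * (2 * \<bar>cos x\<bar>)"
    by (simp add: abs_mult)
  also have "\<dots> \<le> 1 * (2 * \<bar>cos x\<bar>)"
    by (intro mult_right_mono mult_le_one) auto
  finally show ?case
    using Suc.IH by (simp add: y_def algebra_simps)
qed

text \<open>If \<open>cos\<^sup>2 (b x)\<close> is at most \<open>\<epsilon> sin\<^sup>2 (b x)\<close>, the first term on the right suffices. Otherwise
  \<open>cos\<^sup>2 (b x)\<close> exceeds \<open>\<epsilon> / (1 + \<epsilon>)\<close>, so \<open>cos\<^sup>2 x\<close> is bounded below by the previous lemma and the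
  second term suffices.\<close>

lemma cos_odd_multiple_sin_squared_le:
  fixes x \<epsilon> :: real
  assumes "odd b" and "\<epsilon> > 0"
  shows "(cos (real b * x))\<^sup>2 * (sin x)\<^sup>2
    \<le> \<epsilon> * ((sin (real b * x))\<^sup>2 * (sin x)\<^sup>2)
      + (1 + \<epsilon>) * (real b)\<^sup>2 / \<epsilon> * ((cos (real b * x))\<^sup>2 * (cos x)\<^sup>2)"
proof -
  define c s where "c = (cos (real b * x))\<^sup>2" and "s = (sin (real b * x))\<^sup>2"
  have "s = 1 - c"
    by (simp add: c_def s_def sin_squared_eq)
  moreover have "0 \<le> c" "0 \<le> s"
    by (simp_all add: c_def s_def)
  ultimately have cs: "s = 1 - c" "0 \<le> c" "0 \<le> s" .
  have b: "\<bar>cos (real b * x)\<bar> \<le> real b * \<bar>cos x\<bar>"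
    using \<open>odd b\<close> abs_cos_odd_multiple_le[of _ x] by (auto elim!: oddE simp del: of_nat_Suc)
  have cb: "c \<le> (real b)\<^sup>2 * (cos x)\<^sup>2"
    using power_mono[OF b, of 2] by (simp add: c_def power_mult_distrib)
  show ?thesis
  proof (cases "c \<le> \<epsilon> * s")
    case True
    have "c * (sin x)\<^sup>2 \<le> (\<epsilon> * s) * (sin x)\<^sup>2"
      using True by (intro mult_right_mono) auto
    moreover have "0 \<le> (1 + \<epsilon>) * (real b)\<^sup>2 / \<epsilon> * (c * (cos x)\<^sup>2)"
      using \<open>\<epsilon> > 0\<close> cs by simp
    ultimately show ?thesis
      unfolding c_def[symmetric] s_def[symmetric] by (simp add: algebra_simps)
  next
    case False
    then have "\<epsilon> \<le> (1 + \<epsilon>) * c"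
      using cs by (simp add: algebra_simps)
    also have "\<dots> \<le> (1 + \<epsilon>) * ((real b)\<^sup>2 * (cos x)\<^sup>2)"
      using cb \<open>\<epsilon> > 0\<close> by (intro mult_left_mono) auto
    finally have "1 \<le> (1 + \<epsilon>) * (real b)\<^sup>2 / \<epsilon> * (cos x)\<^sup>2"
      using \<open>\<epsilon> > 0\<close> by (simp add: field_simps)
    then have "c * 1 \<le> c * ((1 + \<epsilon>) * (real b)\<^sup>2 / \<epsilon> * (cos x)\<^sup>2)"
      using cs by (intro mult_left_mono)
    moreover have "c * (sin x)\<^sup>2 \<le> c * 1"
      using cs by (intro mult_left_mono) (simp_all add: abs_square_le_1)
    moreover have "0 \<le> \<epsilon> * (s * (sin x)\<^sup>2)"
      using \<open>\<epsilon> > 0\<close> cs by simp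
    ultimately show ?thesis
      unfolding c_def[symmetric] s_def[symmetric] by (simp add: algebra_simps)
  qed
qed

section \<open>Independent random signs\<close>

lemma AE_sign_sequences: "AE \<xi> in sign_sequences. \<forall>j. \<xi> j \<in> {-1, 1}"
proof -
  have "AE x in measure_pmf (pmf_of_set {-1, 1 :: real}). x \<in> {-1, 1}"
    by (simp add: AE_measure_pmf_iff)
  then show ?thesis
    unfolding AE_all_countable sign_sequences_def
    by (intro allI AE_PiM_component measure_pmf.prob_space_axioms) auto
qed

lemma indep_vars_sign_sequences:
  "prob_space.indep_vars sign_sequences (\<lambda>_. measure_pmf (pmf_of_set {-1, 1})) (\<lambda>j \<xi>. \<xi> j) UNIV"
proof -
  interpret prob_space sign_sequences by (rule prob_space_sign_sequences)
  show ?thesis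
  proof (subst indep_vars_iff_distr_eq_PiM)
    show "random_variable (measure_pmf (pmf_of_set {-1, 1})) (\<lambda>\<xi>. \<xi> j)" for j
      unfolding sign_sequences_def by (rule measurable_component_singleton) simp
    have "distr sign_sequences (measure_pmf (pmf_of_set {-1, 1})) (\<lambda>\<xi>. \<xi> j)
        = measure_pmf (pmf_of_set {-1, 1})" for j
      unfolding sign_sequences_def
      by (rule distr_PiM_component) (simp_all add: measure_pmf.prob_space_axioms)
    then show "distr sign_sequences (\<Pi>\<^sub>M j\<in>UNIV. measure_pmf (pmf_of_set {-1, 1})) (\<lambda>\<xi>. \<lambda>j\<in>UNIV. \<xi> j)
        = (\<Pi>\<^sub>M j\<in>UNIV. distr sign_sequences (measure_pmf (pmf_of_set {-1, 1})) (\<lambda>\<xi>. \<xi> j))"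
      by (simp add: sign_sequences_def restrict_UNIV distr_id)
  qed simp
qed

lemma measurable_fun_upd_sign_sequences [measurable]:
  "(\<lambda>\<xi>. \<xi>(j := a)) \<in> measurable sign_sequences sign_sequences"
  unfolding sign_sequences_def
  by (rule measurable_fun_upd[where J = UNIV]) auto

text \<open>A function that ignores coordinate \<open>n\<close> is recognised by being unchanged when that coordinate
  is overwritten. In this form the condition concerns all real sequences, also those outside the
  null set on which the coordinates fail to be signs.\<close>

lemma integral_sign_factor:
  fixes g :: "real \<Rightarrow> complex" and H :: "(nat \<Rightarrow> real) \<Rightarrow> complex"
  assumes H [measurable]: "H \<in> borel_measurable sign_sequences"
    and int: "integrable sign_sequences H"
    and free: "\<And>\<xi>. H (\<xi>(n := 0)) = H \<xi>"
  shows "(LINT \<xi>|sign_sequences. g (\<xi> n) * H \<xi>)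
    = (g 1 + g (- 1)) / 2 * (LINT \<xi>|sign_sequences. H \<xi>)"
    and "integrable sign_sequences (\<lambda>\<xi>. g (\<xi> n) * H \<xi>)"
proof -
  interpret prob_space sign_sequences by (rule prob_space_sign_sequences)
  let ?p = "measure_pmf (pmf_of_set {-1, 1 :: real})"
  have upd: "(\<lambda>\<xi>. \<xi>(n := 0)) \<in> measurable (\<Pi>\<^sub>M j\<in>- {n}. ?p) sign_sequences"
    unfolding sign_sequences_def
    by (rule measurable_fun_upd[where J = "- {n}"]) auto
  have comp: "(\<lambda>\<xi>. \<xi> n) \<in> measurable (\<Pi>\<^sub>M j\<in>{n}. ?p) ?p"
    by (rule measurable_component_singleton) simp
  have "indep_var borel ((\<lambda>\<xi>. g (\<xi> n)) \<circ> (\<lambda>\<xi>. \<lambda>j\<in>{n}. \<xi> j))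
      borel ((\<lambda>\<xi>. H (\<xi>(n := 0))) \<circ> (\<lambda>\<xi>. \<lambda>j\<in>- {n}. \<xi> j))"
    by (rule indep_var_compose[OF indep_var_restrict[OF indep_vars_sign_sequences]])
       (auto intro!: measurable_compose[OF comp] measurable_compose[OF upd H])
  moreover have "(\<lambda>\<xi>. H (\<xi>(n := 0))) \<circ> (\<lambda>\<xi>. \<lambda>j\<in>- {n}. \<xi> j) = H"
  proof
    fix \<xi> :: "nat \<Rightarrow> real"
    have "(\<lambda>j\<in>- {n}. \<xi> j)(n := 0) = \<xi>(n := 0)" by auto
    then show "((\<lambda>\<xi>. H (\<xi>(n := 0))) \<circ> (\<lambda>\<xi>. \<lambda>j\<in>- {n}. \<xi> j)) \<xi> = H \<xi>"
      using free[of \<xi>] by (simp only: comp_def)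
  qed
  ultimately have indep: "indep_var borel (\<lambda>\<xi>. g (\<xi> n)) borel H"
    by (simp add: comp_def)
  have cn: "(\<lambda>\<xi>. \<xi> n) \<in> measurable sign_sequences ?p"
    unfolding sign_sequences_def by (rule measurable_component_singleton) simp
  have distr: "distr sign_sequences ?p (\<lambda>\<xi>. \<xi> n) = ?p"
    unfolding sign_sequences_def
    by (rule distr_PiM_component) (simp_all add: measure_pmf.prob_space_axioms)
  have "integrable ?p g"
    by (rule integrable_measure_pmf_finite) simp
  then have ig: "integrable sign_sequences (\<lambda>\<xi>. g (\<xi> n))"
    by (subst (asm) distr[symmetric], subst (asm) integrable_distr_eq[OF cn]) auto
  have "(LINT \<xi>|sign_sequences. g (\<xi> n)) = (LINT x|?p. g x)"
    using integral_distr[OF cn, of g] by (simp add: distr)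
  also have "\<dots> = (g 1 + g (- 1)) / 2"
    by (subst integral_measure_pmf[of "{-1, 1}"]) (auto simp: scaleR_conv_of_real)
  finally show "(LINT \<xi>|sign_sequences. g (\<xi> n) * H \<xi>)
      = (g 1 + g (- 1)) / 2 * (LINT \<xi>|sign_sequences. H \<xi>)"
    using indep_var_lebesgue_integral[OF indep ig int] by simp
  show "integrable sign_sequences (\<lambda>\<xi>. g (\<xi> n) * H \<xi>)"
    by (rule indep_var_integrable[OF indep ig int])
qed

section \<open>Recovering the signs from the sum of the series\<close>

lemma bernoulli_series_term_le:
  fixes \<rho> d :: real
  assumes "0 < \<rho>" and "\<bar>\<xi> j\<bar> \<le> 1"
  shows "norm (d * \<xi> j * \<rho> ^ Suc j / 2) \<le> \<bar>d\<bar> * \<rho> / 2 * \<rho> ^ j"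
proof -
  have "norm (d * \<xi> j * \<rho> ^ Suc j / 2) = \<bar>\<xi> j\<bar> * (\<bar>d\<bar> * \<rho> / 2 * \<rho> ^ j)"
    using assms by (simp add: abs_mult)
  also have "\<dots> \<le> 1 * (\<bar>d\<bar> * \<rho> / 2 * \<rho> ^ j)"
    using assms by (intro mult_right_mono) auto
  finally show ?thesis by simp
qed

lemma summable_bernoulli_series:
  fixes \<rho> d :: real
  assumes "0 < \<rho>" "\<rho> < 1" and "\<And>j. \<bar>\<xi> j\<bar> \<le> 1"
  shows "summable (\<lambda>j. d * \<xi> j * \<rho> ^ Suc j / 2)"
proof (rule summable_comparison_test')
  show "summable (\<lambda>j. \<bar>d\<bar> * \<rho> / 2 * \<rho> ^ j)"
    using assms by (intro summable_mult summable_geometric) auto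
qed (rule bernoulli_series_term_le[OF assms(1,3)])

lemma abs_bernoulli_series_le:
  fixes \<rho> d :: real
  assumes "0 < \<rho>" "\<rho> < 1" "d > 0" and \<xi>: "\<And>j. \<bar>\<xi> j\<bar> \<le> 1"
  shows "\<bar>bernoulli_series \<rho> d \<xi>\<bar> \<le> d * \<rho> / 2 / (1 - \<rho>)"
proof -
  have geo: "(\<lambda>j. d * \<rho> / 2 * \<rho> ^ j) sums (d * \<rho> / 2 * (1 / (1 - \<rho>)))"
    using assms by (intro sums_mult geometric_sums) auto
  have "norm (d * \<xi> j * \<rho> ^ Suc j / 2) \<le> d * \<rho> / 2 * \<rho> ^ j" for j
    using bernoulli_series_term_le[OF assms(1) \<xi>, of d] \<open>d > 0\<close> by simp
  then have "norm (\<Sum>j. d * \<xi> j * \<rho> ^ Suc j / 2) \<le> (\<Sum>j. d * \<rho> / 2 * \<rho> ^ j)"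
    by (rule norm_suminf_le) (rule sums_summable[OF geo])
  then show ?thesis
    using sums_unique[OF geo] by (simp add: bernoulli_series_def)
qed

lemma bernoulli_series_shift:
  fixes \<rho> d :: real
  assumes "0 < \<rho>" "\<rho> < 1" and \<xi>: "\<And>j. \<bar>\<xi> j\<bar> \<le> 1"
  shows "bernoulli_series \<rho> d \<xi>
    = d * \<rho> / 2 * \<xi> 0 + \<rho> * bernoulli_series \<rho> d (\<lambda>j. \<xi> (Suc j))"
proof -
  have "bernoulli_series \<rho> d \<xi>
      = d * \<xi> 0 * \<rho> ^ Suc 0 / 2 + (\<Sum>j. d * \<xi> (Suc j) * \<rho> ^ Suc (Suc j) / 2)"
    unfolding bernoulli_series_def
    using suminf_split_head[OF summable_bernoulli_series[OF assms(1,2), of \<xi> d]] \<xi> by simp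
  also have "(\<Sum>j. d * \<xi> (Suc j) * \<rho> ^ Suc (Suc j) / 2)
      = (\<Sum>j. \<rho> * (d * \<xi> (Suc j) * \<rho> ^ Suc j / 2))"
    by (rule arg_cong[where f = suminf]) (simp add: fun_eq_iff)
  also have "\<dots> = \<rho> * bernoulli_series \<rho> d (\<lambda>j. \<xi> (Suc j))"
    unfolding bernoulli_series_def
    by (rule suminf_mult, rule summable_bernoulli_series[OF assms(1,2)]) (rule \<xi>)
  finally show ?thesis by simp
qed

text \<open>This isolates the contribution of one sign to the phase of an exponential. The remaining
  sum is written with the coordinate overwritten by 0, as \<open>integral_sign_factor\<close> requires.\<close>

lemma bernoulli_series_remove:
  fixes \<rho> d :: real
  assumes "0 < \<rho>" "\<rho> < 1" and \<xi>: "\<And>j. \<bar>\<xi> j\<bar> \<le> 1"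
  shows "bernoulli_series \<rho> d \<xi> = bernoulli_series \<rho> d (\<xi>(n := 0)) + d * \<xi> n * \<rho> ^ Suc n / 2"
proof -
  have "(\<lambda>j. d * (\<xi>(n := 0)) j * \<rho> ^ Suc j / 2) sums bernoulli_series \<rho> d (\<xi>(n := 0))"
    unfolding bernoulli_series_def
    by (rule summable_sums, rule summable_bernoulli_series[OF assms(1,2)]) (simp add: \<xi>)
  from sums_add[OF this sums_single[of n "\<lambda>j. d * \<xi> j * \<rho> ^ Suc j / 2"]]
  have "(\<lambda>j. d * \<xi> j * \<rho> ^ Suc j / 2) sums
      (bernoulli_series \<rho> d (\<xi>(n := 0)) + d * \<xi> n * \<rho> ^ Suc n / 2)"
    by (rule sums_cong[THEN iffD1, rotated]) auto
  then show ?thesis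
    unfolding bernoulli_series_def[of \<rho> d \<xi>] by (simp add: sums_iff)
qed

definition leading_sign :: "real \<Rightarrow> real" where
  "leading_sign x = (if x \<ge> 0 then 1 else - 1)"

text \<open>Greedy expansion: subtract the first term, whose sign is that of \<open>x\<close>, and rescale. On the
  sum of a series this shifts the sequence of signs by one.\<close>

primrec remainder :: "real \<Rightarrow> real \<Rightarrow> nat \<Rightarrow> real \<Rightarrow> real" where
  "remainder \<rho> d 0 x = x"
| "remainder \<rho> d (Suc n) x
    = (remainder \<rho> d n x - d * \<rho> / 2 * leading_sign (remainder \<rho> d n x)) / \<rho>"

definition digit :: "real \<Rightarrow> real \<Rightarrow> nat \<Rightarrow> real \<Rightarrow> real" where
  "digit \<rho> d n x = leading_sign (remainder \<rho> d n x)"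

lemma measurable_leading_sign [measurable]: "leading_sign \<in> borel_measurable borel"
  unfolding leading_sign_def by measurable

lemma measurable_remainder [measurable]: "remainder \<rho> d n \<in> borel_measurable borel"
  by (induction n) (simp_all add: id_def)

lemma measurable_digit [measurable]: "digit \<rho> d n \<in> borel_measurable borel"
  unfolding digit_def by measurable

lemma digit_cases: "digit \<rho> d n x \<in> {-1, 1}"
  by (simp add: digit_def leading_sign_def)

text \<open>The first term has modulus \<open>d \<rho> / 2\<close>, and \<open>\<rho> < 1/2\<close> says exactly that the geometric series
  bounding all later terms is smaller, because \<open>\<rho> / (1 - \<rho>) < 1\<close>.\<close>

lemma leading_sign_bernoulli_series:
  fixes \<rho> d :: real
  assumes "0 < \<rho>" "\<rho> < 1 / 2" "d > 0" and \<xi>: "\<And>j. \<xi> j \<in> {-1, 1}"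
  shows "leading_sign (bernoulli_series \<rho> d \<xi>) = \<xi> 0"
proof -
  have \<xi>1: "\<bar>\<xi> j\<bar> \<le> 1" for j using \<xi>[of j] by auto
  define y where "y = \<rho> * bernoulli_series \<rho> d (\<lambda>j. \<xi> (Suc j))"
  have "\<bar>y\<bar> \<le> \<rho> * (d * \<rho> / 2 / (1 - \<rho>))"
    unfolding y_def abs_mult abs_of_pos[OF \<open>0 < \<rho>\<close>]
    using assms \<xi>1 by (intro mult_left_mono abs_bernoulli_series_le) auto
  also have "\<dots> = d * \<rho> / 2 * (\<rho> / (1 - \<rho>))" by simp
  also have "\<dots> < d * \<rho> / 2 * 1"
    using assms by (intro mult_strict_left_mono) auto
  finally have "\<bar>y\<bar> < d * \<rho> / 2" by simp
  moreover have "bernoulli_series \<rho> d \<xi> = d * \<rho> / 2 * \<xi> 0 + y"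
    unfolding y_def using assms \<xi>1 by (intro bernoulli_series_shift) auto
  ultimately show ?thesis
    using \<xi>[of 0] by (auto simp: leading_sign_def)
qed

lemma digit_bernoulli_series:
  fixes \<rho> d :: real
  assumes "0 < \<rho>" "\<rho> < 1 / 2" "d > 0" and \<xi>: "\<And>j. \<xi> j \<in> {-1, 1}"
  shows "digit \<rho> d n (bernoulli_series \<rho> d \<xi>) = \<xi> n"
proof -
  have \<xi>1: "\<bar>\<xi> j\<bar> \<le> 1" for j using \<xi>[of j] by auto
  have "remainder \<rho> d n (bernoulli_series \<rho> d \<xi>) = bernoulli_series \<rho> d (\<lambda>j. \<xi> (n + j))"
  proof (induction n)
    case (Suc n)
    have "leading_sign (bernoulli_series \<rho> d (\<lambda>j. \<xi> (n + j))) = \<xi> n"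
      using leading_sign_bernoulli_series[of \<rho> d "\<lambda>j. \<xi> (n + j)"] assms by simp
    moreover have "bernoulli_series \<rho> d (\<lambda>j. \<xi> (n + j))
        = d * \<rho> / 2 * \<xi> n + \<rho> * bernoulli_series \<rho> d (\<lambda>j. \<xi> (n + Suc j))"
      using bernoulli_series_shift[of \<rho> "\<lambda>j. \<xi> (n + j)" d] assms \<xi>1 by simp
    ultimately show ?case
      using Suc assms by simp
  qed simp
  then show ?thesis
    using leading_sign_bernoulli_series[of \<rho> d "\<lambda>j. \<xi> (n + j)"] assms
    by (simp add: digit_def)
qed

section \<open>Fourier coefficients of functions of two signs\<close>

lemma cnj_exponential: "cnj (exponential l x) = cis (- (2 * pi * l * x))"
  by (simp add: exponential_def cis_conv_exp exp_cnj mult_ac)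

text \<open>Splitting off the two signs is enough: the factor \<open>P\<close> is the same for all \<open>u\<close> and \<open>v\<close>, so the
  infinite product formula for the Fourier transform never enters.\<close>

lemma L2_inner_two_digits:
  fixes \<rho> d l :: real and u v :: "real \<Rightarrow> complex"
  assumes \<rho>: "0 < \<rho>" "\<rho> < 1 / 2" "d > 0" and "p \<noteq> q"
    and [measurable]: "u \<in> borel_measurable borel" "v \<in> borel_measurable borel"
  defines "\<alpha> \<equiv> (\<lambda>j. pi * l * d * \<rho> ^ Suc j)"
  defines "P \<equiv> (LINT \<xi>|sign_sequences. cis (- (2 * pi * l * bernoulli_series \<rho> d (\<xi>(p := 0, q := 0)))))"
  shows "L2_inner (bernoulli_convolution \<rho> d) (\<lambda>x. u (digit \<rho> d p x) * v (digit \<rho> d q x)) (exponential l)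
    = (u 1 * cis (- \<alpha> p) + u (- 1) * cis (\<alpha> p)) / 2
      * ((v 1 * cis (- \<alpha> q) + v (- 1) * cis (\<alpha> q)) / 2 * P)"
proof -
  interpret prob_space sign_sequences by (rule prob_space_sign_sequences)
  have cis_meas [measurable]: "cis \<in> borel_measurable borel"
    by (intro borel_measurable_continuous_onI continuous_intros)
  define R where "R \<xi> = cis (- (2 * pi * l * bernoulli_series \<rho> d (\<xi>(p := 0, q := 0))))"
    for \<xi> :: "nat \<Rightarrow> real"
  have R [measurable]: "R \<in> borel_measurable sign_sequences"
    unfolding R_def by measurable
  have intR: "integrable sign_sequences R"
    by (rule integrable_const_bound[of _ 1]) (auto simp: R_def)
  have R_free: "R (\<xi>(q := 0)) = R \<xi>" for \<xi>
    using \<open>p \<noteq> q\<close> by (simp add: R_def fun_upd_twist)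
  let ?g = "\<lambda>j w x. w x * cis (- (\<alpha> j * x)) :: complex"
  have "L2_inner (bernoulli_convolution \<rho> d) (\<lambda>x. u (digit \<rho> d p x) * v (digit \<rho> d q x)) (exponential l)
      = (LINT \<xi>|sign_sequences. u (digit \<rho> d p (bernoulli_series \<rho> d \<xi>))
          * v (digit \<rho> d q (bernoulli_series \<rho> d \<xi>)) * cis (- (2 * pi * l * bernoulli_series \<rho> d \<xi>)))"
    unfolding L2_inner_def bernoulli_convolution_def cnj_exponential
    by (subst integral_distr) auto
  also have "\<dots> = (LINT \<xi>|sign_sequences. ?g p u (\<xi> p) * (?g q v (\<xi> q) * R \<xi>))"
  proof (rule integral_cong_AE)
    show "AE \<xi> in sign_sequences. u (digit \<rho> d p (bernoulli_series \<rho> d \<xi>))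
          * v (digit \<rho> d q (bernoulli_series \<rho> d \<xi>)) * cis (- (2 * pi * l * bernoulli_series \<rho> d \<xi>))
        = ?g p u (\<xi> p) * (?g q v (\<xi> q) * R \<xi>)"
      using AE_sign_sequences
    proof eventually_elim
      case (elim \<xi>)
      have \<xi>1: "\<bar>\<xi> j\<bar> \<le> 1" for j using elim[rule_format, of j] by auto
      have "bernoulli_series \<rho> d \<xi> = bernoulli_series \<rho> d (\<xi>(p := 0)) + d * \<xi> p * \<rho> ^ Suc p / 2"
        using \<rho> \<xi>1 by (intro bernoulli_series_remove) auto
      also have "bernoulli_series \<rho> d (\<xi>(p := 0))
          = bernoulli_series \<rho> d (\<xi>(p := 0, q := 0)) + d * (\<xi>(p := 0)) q * \<rho> ^ Suc q / 2"
        using \<rho> \<xi>1 by (intro bernoulli_series_remove) auto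
      finally have "- (2 * pi * l * bernoulli_series \<rho> d \<xi>)
          = - (\<alpha> p * \<xi> p) + (- (\<alpha> q * \<xi> q)
            + - (2 * pi * l * bernoulli_series \<rho> d (\<xi>(p := 0, q := 0))))"
        using \<open>p \<noteq> q\<close> by (simp add: \<alpha>_def algebra_simps)
      then have "cis (- (2 * pi * l * bernoulli_series \<rho> d \<xi>))
          = cis (- (\<alpha> p * \<xi> p)) * (cis (- (\<alpha> q * \<xi> q)) * R \<xi>)"
        by (simp only: cis_mult[symmetric] R_def)
      then show ?case
        using digit_bernoulli_series[of \<rho> d \<xi>] \<rho> elim by simp
    qed
  qed measurable
  also have "\<dots> = (?g p u 1 + ?g p u (- 1)) / 2 * (LINT \<xi>|sign_sequences. ?g q v (\<xi> q) * R \<xi>)"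
  proof (rule integral_sign_factor)
    show "integrable sign_sequences (\<lambda>\<xi>. ?g q v (\<xi> q) * R \<xi>)"
      by (rule integral_sign_factor(2)[OF R intR R_free])
    show "?g q v ((\<xi>(p := 0)) q) * R (\<xi>(p := 0)) = ?g q v (\<xi> q) * R \<xi>" for \<xi>
      using \<open>p \<noteq> q\<close> by (simp add: R_def)
  qed measurable
  also have "(LINT \<xi>|sign_sequences. ?g q v (\<xi> q) * R \<xi>)
      = (?g q v 1 + ?g q v (- 1)) / 2 * (LINT \<xi>|sign_sequences. R \<xi>)"
    by (rule integral_sign_factor(1)[OF R intR R_free])
  finally show ?thesis
    by (simp add: R_def P_def)
qed

lemma cmod_L2_inner_two_digits:
  fixes \<rho> d l :: real
  assumes "0 < \<rho>" "\<rho> < 1 / 2" "d > 0" and "p \<noteq> q"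
  defines "\<alpha> \<equiv> (\<lambda>j. pi * l * d * \<rho> ^ Suc j)" and "M \<equiv> bernoulli_convolution \<rho> d"
  obtains P where "0 \<le> P" "P \<le> 1"
    and "(cmod (L2_inner M (\<lambda>_. 1) (exponential l)))\<^sup>2 = P * ((cos (\<alpha> p))\<^sup>2 * (cos (\<alpha> q))\<^sup>2)"
    and "(cmod (L2_inner M (\<lambda>x. complex_of_real (digit \<rho> d q x)) (exponential l)))\<^sup>2
      = P * ((cos (\<alpha> p))\<^sup>2 * (sin (\<alpha> q))\<^sup>2)"
    and "(cmod (L2_inner M (\<lambda>x. complex_of_real (digit \<rho> d p x) * complex_of_real (digit \<rho> d q x))
        (exponential l)))\<^sup>2 = P * ((sin (\<alpha> p))\<^sup>2 * (sin (\<alpha> q))\<^sup>2)"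
proof -
  interpret prob_space sign_sequences by (rule prob_space_sign_sequences)
  have cis_meas [measurable]: "cis \<in> borel_measurable borel"
    by (intro borel_measurable_continuous_onI continuous_intros)
  define P0 where
    "P0 = (LINT \<xi>|sign_sequences. cis (- (2 * pi * l * bernoulli_series \<rho> d (\<xi>(p := 0, q := 0)))))"
  note coeff = L2_inner_two_digits[OF assms(1-4), of _ _ l, folded P0_def M_def]
  have c: "(cis (- a) + cis a) / 2 = complex_of_real (cos a)" for a
    by (simp add: complex_eq_iff)
  have s: "(cis (- a) - cis a) / 2 = - \<i> * complex_of_real (sin a)" for a
    by (simp add: complex_eq_iff)
  have "cmod P0 \<le> (LINT \<xi>|sign_sequences. cmod
      (cis (- (2 * pi * l * bernoulli_series \<rho> d (\<xi>(p := 0, q := 0))))))"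
    unfolding P0_def by (rule integral_norm_bound)
  then have "cmod P0 \<le> 1" by (simp add: prob_space)
  show thesis
  proof (rule that[of "(cmod P0)\<^sup>2"])
    show "(cmod P0)\<^sup>2 \<le> 1" using \<open>cmod P0 \<le> 1\<close> by (simp add: power_le_one)
    show "(cmod (L2_inner M (\<lambda>_. 1) (exponential l)))\<^sup>2
        = (cmod P0)\<^sup>2 * ((cos (\<alpha> p))\<^sup>2 * (cos (\<alpha> q))\<^sup>2)"
      using coeff[of "\<lambda>_. 1" "\<lambda>_. 1"]
      by (simp add: c \<alpha>_def norm_mult power_mult_distrib)
    show "(cmod (L2_inner M (\<lambda>x. complex_of_real (digit \<rho> d q x)) (exponential l)))\<^sup>2
        = (cmod P0)\<^sup>2 * ((cos (\<alpha> p))\<^sup>2 * (sin (\<alpha> q))\<^sup>2)"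
      using coeff[of "\<lambda>_. 1" complex_of_real]
      by (simp add: c s \<alpha>_def norm_mult power_mult_distrib)
    show "(cmod (L2_inner M (\<lambda>x. complex_of_real (digit \<rho> d p x) * complex_of_real (digit \<rho> d q x))
        (exponential l)))\<^sup>2 = (cmod P0)\<^sup>2 * ((sin (\<alpha> p))\<^sup>2 * (sin (\<alpha> q))\<^sup>2)"
      using coeff[of complex_of_real complex_of_real]
      by (simp add: s \<alpha>_def norm_mult power_mult_distrib)
  qed simp
qed

section \<open>Failure of the lower frame bound\<close>

lemma unimodular_L2:
  assumes "prob_space M" and "f \<in> borel_measurable M" and "\<And>x. cmod (f x) = 1"
  shows "f \<in> L2_functions M" and "L2_norm M f = 1"
proof -
  interpret prob_space M by fact
  show "f \<in> L2_functions M" "L2_norm M f = 1"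
    using assms(2,3) by (simp_all add: L2_functions_def L2_norm_def prob_space)
qed

lemma summable_on_finite_tail:
  fixes f :: "'a \<Rightarrow> real"
  assumes "f summable_on A" and "\<delta> > 0"
  obtains F where "finite F" "F \<subseteq> A" "infsum f (A - F) < \<delta>"
proof -
  obtain F where F: "finite F" "F \<subseteq> A" "dist (sum f F) (infsum f A) \<le> \<delta> / 2"
    using infsum_finite_approximation[OF assms(1), of "\<delta> / 2"] \<open>\<delta> > 0\<close> by auto
  have "infsum f (A - F) = infsum f A - sum f F"
    using assms(1) F by (subst infsum_Diff) auto
  also have "\<dots> \<le> \<delta> / 2"
    using F(3) unfolding dist_real_def by linarith
  also have "\<dots> < \<delta>" using \<open>\<delta> > 0\<close> by simp
  finally show thesis by (rule that[OF F(1,2)])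
qed

theorem theorem1p1:
  fixes \<rho> d :: real and m :: nat and B :: int
  assumes "0 < \<rho>" and "\<rho> < 1 / 2" and "d > 0"
    and "m \<ge> 1" and "B \<ge> 3" and "odd B"
    and "\<rho> powi (- int m) = of_int B"
  shows "\<not> admits_fourier_frame (bernoulli_convolution \<rho> d)"
proof
  let ?M = "bernoulli_convolution \<rho> d"
  interpret prob_space ?M by (rule prob_space_bernoulli_convolution)
  define b where "b = nat B"
  have b: "odd b" "real b = of_int B"
    using \<open>B \<ge> 3\<close> \<open>odd B\<close> by (auto simp: b_def even_nat_iff)
  have b\<rho>: "real b * \<rho> ^ m = 1"
    using assms(7) \<open>0 < \<rho>\<close> unfolding b(2) by (simp add: power_int_minus field_simps)
  define \<alpha> where "\<alpha> j l = pi * l * d * \<rho> ^ Suc j" for j and l :: real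
  have \<alpha>: "\<alpha> n l = real b * \<alpha> (n + m) l" for n l
    using b\<rho> by (simp add: \<alpha>_def power_add mult_ac)
  define E where "E f l = (cmod (L2_inner ?M f (exponential l)))\<^sup>2" for f l
  define r where "r n x = complex_of_real (digit \<rho> d n x)" for n x
  have r_meas [measurable]: "r n \<in> borel_measurable borel" for n
    unfolding r_def by measurable
  have r_norm: "cmod (r n x) = 1" for n x
    using digit_cases[of \<rho> d n x] by (auto simp: r_def)
  have E_nonneg: "0 \<le> E f l" for f l by (simp add: E_def)

  \<comment> \<open>The factor collecting the other signs is common to the three coefficients, so the
    trigonometric inequality passes to them.\<close>
  have compare: "E (r (n + m)) l
      \<le> \<epsilon> * E (\<lambda>x. r n x * r (n + m) x) l + (1 + \<epsilon>) * (real b)\<^sup>2 / \<epsilon> * E (\<lambda>_. 1) l"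
    if "\<epsilon> > 0" for \<epsilon> n l
  proof -
    obtain P where P: "0 \<le> P"
      "E (\<lambda>_. 1) l = P * ((cos (\<alpha> n l))\<^sup>2 * (cos (\<alpha> (n + m) l))\<^sup>2)"
      "E (r (n + m)) l = P * ((cos (\<alpha> n l))\<^sup>2 * (sin (\<alpha> (n + m) l))\<^sup>2)"
      "E (\<lambda>x. r n x * r (n + m) x) l = P * ((sin (\<alpha> n l))\<^sup>2 * (sin (\<alpha> (n + m) l))\<^sup>2)"
      using cmod_L2_inner_two_digits[OF assms(1-3), of n "n + m" l] \<open>m \<ge> 1\<close>
      unfolding E_def r_def \<alpha>_def by auto
    show ?thesis
      using mult_left_mono[OF cos_odd_multiple_sin_squared_le[OF b(1) that, of "\<alpha> (n + m) l"] P(1)]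
      unfolding P(2-4) \<alpha>[of n l] by (simp add: algebra_simps)
  qed

  have vanish: "(\<lambda>n. E (r (n + m)) l) \<longlonglongrightarrow> 0" for l
  proof (rule tendsto_sandwich)
    show "eventually (\<lambda>n. 0 \<le> E (r (n + m)) l) sequentially"
      by (simp add: E_nonneg)
    have "E (r (n + m)) l \<le> (sin (\<alpha> (n + m) l))\<^sup>2" for n
    proof -
      obtain P where P: "0 \<le> P" "P \<le> 1"
        "E (r (n + m)) l = P * ((cos (\<alpha> n l))\<^sup>2 * (sin (\<alpha> (n + m) l))\<^sup>2)"
        using cmod_L2_inner_two_digits[OF assms(1-3), of n "n + m" l] \<open>m \<ge> 1\<close>
        unfolding E_def r_def \<alpha>_def by auto
      have "P * (cos (\<alpha> n l))\<^sup>2 \<le> 1"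
        using P by (intro mult_le_one) (simp_all add: abs_square_le_1)
      then show ?thesis
        using mult_right_mono[of "P * (cos (\<alpha> n l))\<^sup>2" 1 "(sin (\<alpha> (n + m) l))\<^sup>2"]
        by (simp add: P(3) mult_ac)
    qed
    then show "eventually (\<lambda>n. E (r (n + m)) l \<le> (sin (\<alpha> (n + m) l))\<^sup>2) sequentially"
      by simp
    have "(\<lambda>n. \<rho> ^ n) \<longlonglongrightarrow> 0"
      using assms by (intro LIMSEQ_power_zero) auto
    then have "(\<lambda>n. (sin (pi * l * d * \<rho> ^ Suc m * \<rho> ^ n))\<^sup>2)
        \<longlonglongrightarrow> (sin (pi * l * d * \<rho> ^ Suc m * 0))\<^sup>2"
      by (intro tendsto_power tendsto_sin tendsto_mult tendsto_const)
    then show "(\<lambda>n. (sin (\<alpha> (n + m) l))\<^sup>2) \<longlonglongrightarrow> 0"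
      by (simp add: \<alpha>_def power_add mult_ac)
  qed simp

  assume "admits_fourier_frame ?M"
  then obtain \<Lambda> A C where AC: "0 < A" "A \<le> C"
    and frame: "\<And>f. f \<in> L2_functions ?M \<Longrightarrow> E f summable_on \<Lambda> \<and>
      A * (L2_norm ?M f)\<^sup>2 \<le> infsum (E f) \<Lambda> \<and> infsum (E f) \<Lambda> \<le> C * (L2_norm ?M f)\<^sup>2"
    unfolding admits_fourier_frame_def fourier_frame_spectrum_def E_def by blast
  have unit: "E f summable_on \<Lambda>" "A \<le> infsum (E f) \<Lambda>" "infsum (E f) \<Lambda> \<le> C"
    if "f \<in> borel_measurable borel" "\<And>x. cmod (f x) = 1" for f
  proof -
    have "f \<in> borel_measurable ?M"
      using that(1) by (simp cong: measurable_cong_sets)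
    note f = unimodular_L2[OF prob_space_axioms this that(2)]
    show "E f summable_on \<Lambda>" "A \<le> infsum (E f) \<Lambda>" "infsum (E f) \<Lambda> \<le> C"
      using frame[OF f(1)] by (simp_all add: f(2))
  qed
  \<comment> \<open>With these choices \<open>\<epsilon> C\<close> and \<open>K\<close> times the tail of the constant function are each at most
    \<open>A / 4\<close>.\<close>
  define \<epsilon> where "\<epsilon> = A / (4 * C)"
  define K where "K = (1 + \<epsilon>) * (real b)\<^sup>2 / \<epsilon>"
  have "\<epsilon> > 0" using AC by (simp add: \<epsilon>_def)
  moreover have "b > 0" using b(1) by (cases b) auto
  ultimately have "K > 0" by (simp add: K_def)
  obtain F where F: "finite F" "F \<subseteq> \<Lambda>" "infsum (E (\<lambda>_. 1)) (\<Lambda> - F) < A / (4 * K)"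
    using summable_on_finite_tail[OF unit(1)[of "\<lambda>_. 1"], of "A / (4 * K)"] AC \<open>K > 0\<close> by auto

  have "A / 2 \<le> (\<Sum>l\<in>F. E (r (n + m)) l)" for n
  proof -
    let ?s = "E (r (n + m))" and ?c = "E (\<lambda>x. r n x * r (n + m) x)" and ?o = "E (\<lambda>_. 1)"
    have s: "?s summable_on \<Lambda>" "A \<le> infsum ?s \<Lambda>"
      using unit[of "r (n + m)"] r_norm by auto
    have c: "?c summable_on \<Lambda>" "infsum ?c \<Lambda> \<le> C"
      using unit[of "\<lambda>x. r n x * r (n + m) x"] r_norm by (auto simp: norm_mult)
    have o: "?o summable_on \<Lambda>"
      using unit[of "\<lambda>_. 1"] by auto
    note tail = summable_on_subset_banach[OF _ Diff_subset[of \<Lambda> F]]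
    have "infsum ?s (\<Lambda> - F) \<le> (\<Sum>\<^sub>\<infinity>l\<in>\<Lambda> - F. \<epsilon> * ?c l + K * ?o l)"
      using compare[OF \<open>\<epsilon> > 0\<close>, of n, folded K_def] tail[OF s(1)] tail[OF c(1)] tail[OF o]
      by (intro infsum_mono summable_on_add summable_on_cmult_right) auto
    also have "\<dots> = \<epsilon> * infsum ?c (\<Lambda> - F) + K * infsum ?o (\<Lambda> - F)"
      using tail[OF c(1)] tail[OF o]
      by (simp add: infsum_add summable_on_cmult_right infsum_cmult_right')
    also have "\<dots> \<le> \<epsilon> * C + K * (A / (4 * K))"
    proof (intro add_mono mult_left_mono)
      have "infsum ?c (\<Lambda> - F) \<le> infsum ?c \<Lambda>"
        using c(1) tail[OF c(1)] E_nonneg by (intro infsum_mono2) auto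
      then show "infsum ?c (\<Lambda> - F) \<le> C" using c(2) by simp
    qed (use \<open>\<epsilon> > 0\<close> \<open>K > 0\<close> F(3) in auto)
    also have "\<dots> = A / 2"
      using AC \<open>K > 0\<close> by (simp add: \<epsilon>_def)
    finally have "infsum ?s (\<Lambda> - F) \<le> A / 2" .
    moreover have "infsum ?s (\<Lambda> - F) = infsum ?s \<Lambda> - sum ?s F"
      using s(1) F by (subst infsum_Diff) auto
    ultimately show ?thesis using s(2) by simp
  qed
  moreover have "(\<lambda>n. \<Sum>l\<in>F. E (r (n + m)) l) \<longlonglongrightarrow> (\<Sum>l\<in>F. 0)"
    by (intro tendsto_sum vanish)
  ultimately have "A / 2 \<le> 0"
    by (intro LIMSEQ_le_const[of _ 0 "A / 2"]) auto
  with AC show False by simp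
qed

end
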